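(* Let $\|\cdot\|_E$ denote the Euclidean norm on $\mathbb{R}^2$ and let $\|\cdot\|_X$ be any norm on $\mathbb{R}^2$ such that $\mathbf{B}_E\subseteq \mathbf{B}_X\subseteq K\mathbf{B}_E$ for some real $K\geq 1$. Then for all $x,y\in\mathbf{S}_X$, $$\|x-y\|_X\leq d_{X,\mathbf{S}_X}(x,y)\leq K^3\,\frac{\pi}{2}\,\|x-y\|_X.$$
   Context: For a norm $\|\cdot\|_A$ on $\mathbb{R}^2$, $\mathbf{B}_A:=\{w:\|w\|_A\leq 1\}$ is the closed unit ball and $\mathbf{S}_A:=\{w:\|w\|_A=1\}$ is the unit sphere. The length of a continuous path $\rho:[0,1]\to\mathbf{S}_X$ with respect to $\|\cdot\|_X$ is $$L_X(\rho):=\sup\left\{\sum_{j=0}^{n-1}\|\rho(t_j)-\rho(t_{j+1})\|_X \;:\; n\in\mathbb{N},\ 0=t_0<\dots<t_n=1\right\}\in[0,\infty],$$ and the intrinsic metric on $\mathbf{S}_X$ with respect to $\|\cdot\|_X$ is $$d_{X,\mathbf{S}_X}(x,y):=\inf\{L_X(\rho) : \rho:[0,1]\to\mathbf{S}_X \text{ continuous},\ \rho(0)=x,\ \rho(1)=y\}.$$ *)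

theory Defs
  imports "HOL-Analysis.Analysis"
begin

definition is_norm :: "('a::real_vector \<Rightarrow> real) \<Rightarrow> bool" where
  "is_norm N \<longleftrightarrow>
     (\<forall>w. 0 \<le> N w) \<and>
     (\<forall>w. N w = 0 \<longleftrightarrow> w = 0) \<and>
     (\<forall>c w. N (c *\<^sub>R w) = \<bar>c\<bar> * N w) \<and>
     (\<forall>v w. N (v + w) \<le> N v + N w)"

definition unit_ball :: "('a \<Rightarrow> real) \<Rightarrow> 'a set" where
  "unit_ball N = {w. N w \<le> 1}"

definition unit_sphere :: "('a \<Rightarrow> real) \<Rightarrow> 'a set" where
  "unit_sphere N = {w. N w = 1}"

text \<open>Only the values of \<open>p\<close> on \<open>{0..1}\<close> and of \<open>t\<close> on \<open>{0..n}\<close> matter.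
  The case \<open>n = 0\<close> is excluded by \<open>t 0 = 0\<close> and \<open>t n = 1\<close>.\<close>

definition path_length :: "('a::real_vector \<Rightarrow> real) \<Rightarrow> (real \<Rightarrow> 'a) \<Rightarrow> ennreal" where
  "path_length N p =
     Sup {ennreal (\<Sum>j<n. N (p (t j) - p (t (Suc j)))) | n t.
            strict_mono_on {0..n} t \<and> t 0 = 0 \<and> t n = 1}"

text \<open>Continuity of paths refers to the standard topology of the ambient space; in finite
  dimension this is the topology of any norm. The infimum over no paths is \<open>\<infinity>\<close>.\<close>

definition intrinsic_dist ::
    "('a::real_normed_vector \<Rightarrow> real) \<Rightarrow> 'a \<Rightarrow> 'a \<Rightarrow> ennreal" where
  "intrinsic_dist N x y =
     Inf {path_length N p | p.
            path p \<and> path_image p \<subseteq> unit_sphere N \<and> pathstart p = x \<and> pathfinish p = y}"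

end

theory Submission
  imports Defs
begin

text \<open>Radial projection of the Euclidean unit circle onto the unit sphere of \<open>X\<close> is
  \<open>K\<^sup>2\<close>-Lipschitz: a chord of the sphere of \<open>X\<close> that comes close to the origin must contain the
  corresponding chord of the Euclidean disc, so it subtends a large angle. Since \<open>\<parallel>x\<parallel>, \<parallel>y\<parallel> \<ge> 1\<close>,
  the points \<open>x\<close> and \<open>y\<close> are the projections of two points of the circle at Euclidean distance at
  most \<open>\<parallel>x - y\<parallel> \<le> K X(x - y)\<close>; these are joined by an arc longer than their distance by a factor
  of at most \<open>\<pi>/2\<close>, and the projection of this arc is the required path.\<close>

section \<open>Lipschitz bounds for radial projections\<close>

text \<open>Division by \<open>N u * N v\<close> turns the left side into the distance between the
  projected points \<open>u /\<^sub>R N u\<close> and \<open>v /\<^sub>R N v\<close>. The proof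
  compares squares and splits on where the foot of the perpendicular from the origin to the line
  through these points lies.\<close>

lemma norm_cross_scaled_le:
  fixes N :: "'a::real_inner \<Rightarrow> real" and u v :: 'a
  assumes N: "is_norm N" "\<And>w. N w \<le> norm w"
    and uv: "norm u = 1" "norm v = 1"
  shows "norm (N v *\<^sub>R u - N u *\<^sub>R v) \<le> norm (u - v)"
  using uv
proof (induction "N u" "N v" arbitrary: u v rule: linorder_wlog)
  case sym
  then show ?case
    by (metis norm_minus_commute)
next
  case (le u v)
  define a b c where "a = N u" and "b = N v" and "c = inner u v"
  have hom: "N (r *\<^sub>R w) = \<bar>r\<bar> * N w" and tri: "N (w + z) \<le> N w + N z" for r w z
    using N(1) by (auto simp: is_norm_def)
  have uu: "inner u u = 1" and vv: "inner v v = 1"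
    using le by (auto simp: dot_square_norm)
  have "u \<noteq> 0" "v \<noteq> 0" using le by auto
  then have ab: "0 < a" "0 < b" "a \<le> 1" "b \<le> 1"
    using N le unfolding a_def b_def is_norm_def by (metis order_less_le)+
  have c: "\<bar>c\<bar> \<le> 1"
    using Cauchy_Schwarz_ineq2[of u v] le by (simp add: c_def)
  define w where "w = b *\<^sub>R u - a *\<^sub>R v"
  define f where "f = a\<^sup>2 + b\<^sup>2 - 2 * a * b * c"
  have ww: "inner w w = f"
    using uu vv
    by (simp add: w_def f_def c_def inner_diff inner_commute power2_eq_square algebra_simps)
  have dist: "inner (u - v) (u - v) = 2 - 2 * c"
    using uu vv by (simp add: c_def inner_diff inner_commute)
  have "f \<le> 2 - 2 * c"
  \<comment> \<open>Since \<open>a \<le> b\<close>, the end \<open>v /\<^sub>R b\<close> of the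
    chord is at least as near to the origin as the other end. The condition is equivalent to
    \<open>0 \<le> inner v w\<close>: the foot lies at this end or beyond it.\<close>
  proof (cases "a \<le> c * b")
    case False
    have "a * c \<le> b"
      using c ab le(1) unfolding a_def[symmetric] b_def[symmetric]
      by (smt (verit) mult_left_le)
    \<comment> \<open>The left side is \<open>f\<close>. Its two brackets are nonnegative, so the
      outer factors \<open>a\<close> and \<open>b\<close> may be raised to 1.\<close>
    then have "a * (a - c * b) + b * (b - a * c) \<le> 1 * (a - c * b) + 1 * (b - a * c)"
      using ab False by (intro add_mono mult_right_mono) auto
    also have "\<dots> = (1 - c) * (a + b)"
      by (simp add: algebra_simps)
    also have "\<dots> \<le> (1 - c) * 2"
      using ab c by (intro mult_left_mono) auto
    finally show ?thesis
      by (simp add: f_def power2_eq_square algebra_simps)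
  next
    case True
    define m where "m = b * c - a"
    define s where "s = 1 - c\<^sup>2"
    have m: "0 \<le> m" using True by (simp add: m_def mult.commute)
    have f0: "0 \<le> f" using ww inner_ge_zero by metis
    have s0: "0 \<le> s" using c by (simp add: s_def abs_square_le_1)
    \<comment> \<open>\<open>e\<close> is the component of \<open>v\<close> orthogonal to the chord, scaled by \<open>f\<close>: it points to the foot
      of the perpendicular from the origin, which lies beyond the end \<open>v / b\<close> of the chord.\<close>
    define e where "e = f *\<^sub>R v - m *\<^sub>R w"
    have vw: "inner v w = m"
      using vv by (simp add: w_def m_def c_def inner_diff inner_commute)
    have "inner e e = f * (b\<^sup>2 * s)"
    proof -
      have "inner e e = f * (f - m\<^sup>2)"
        using vw ww vv
        by (simp add: e_def inner_diff inner_commute power2_eq_square algebra_simps)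
      also have "f - m\<^sup>2 = b\<^sup>2 * s"
        by (simp add: f_def m_def s_def power2_eq_square algebra_simps)
      finally show ?thesis .
    qed
    then have ne: "norm e = sqrt f * b * sqrt s"
      using ab by (simp add: norm_eq_sqrt_inner real_sqrt_mult)
    \<comment> \<open>A nonnegative multiple of \<open>v\<close> is split along \<open>e\<close> and
      \<open>u\<close>. Subadditivity then bounds \<open>N v\<close> through \<open>norm e\<close>
      and \<open>N u\<close>, and the terms \<open>a * m * b\<close> cancel.\<close>
    have "(f + a * m) *\<^sub>R v = e + (m * b) *\<^sub>R u"
      by (simp add: e_def w_def algebra_simps)
    then have "N ((f + a * m) *\<^sub>R v) \<le> norm e + (m * b) * a"
      using tri[of e "(m * b) *\<^sub>R u"] N(2)[of e] hom[of "m * b" u] m ab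
      by (simp add: a_def)
    then have "(f + a * m) * b \<le> sqrt f * b * sqrt s + m * b * a"
      using hom[of "f + a * m" v] f0 m ab ne by (simp add: b_def)
    then have "b * f \<le> b * (sqrt f * sqrt s)"
      by (simp add: algebra_simps)
    then have "sqrt f * sqrt f \<le> sqrt f * sqrt s"
      using ab f0 by simp
    \<comment> \<open>For \<open>f \<noteq> 0\<close> the line through the two points has distance
      \<open>sqrt (s / f)\<close> from the origin, so it misses the open unit ball of
      \<open>norm\<close>.\<close>
    then have "f \<le> s"
      using f0 s0 by (cases "f = 0") (auto simp del: real_sqrt_mult_self)
    also have "s = (1 - c) * (1 + c)"
      by (simp add: s_def power2_eq_square algebra_simps)
    also have "\<dots> \<le> (1 - c) * 2"
      using c by (intro mult_left_mono) auto
    finally show ?thesis by simp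
  qed
  then show ?case
    using ww dist by (simp add: norm_eq_sqrt_inner w_def a_def b_def)
qed

text \<open>Both \<open>N u\<close> and \<open>N v\<close> are at least \<open>1 / K\<close>, so
  dividing the preceding estimate by \<open>N u * N v\<close> costs the factor
  \<open>K\<^sup>2\<close>.\<close>

lemma norm_radial_projection_diff_le:
  fixes N :: "'a::real_inner \<Rightarrow> real" and u v :: 'a
  assumes N: "is_norm N" "\<And>w. N w \<le> norm w" "\<And>w. norm w \<le> K * N w"
    and uv: "norm u = 1" "norm v = 1" and K: "0 < K"
  shows "norm (u /\<^sub>R N u - v /\<^sub>R N v) \<le> K\<^sup>2 * norm (u - v)"
proof -
  have lower: "1 / K \<le> N u" "1 / K \<le> N v"
    using N(3)[of u] N(3)[of v] uv K by (auto simp: field_simps)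
  then have pos: "0 < N u" "0 < N v"
    using K by (auto intro: less_le_trans[rotated])
  have "u /\<^sub>R N u - v /\<^sub>R N v = (N v *\<^sub>R u - N u *\<^sub>R v) /\<^sub>R (N u * N v)"
    using pos by (simp add: scaleR_diff_right field_simps)
  then have "norm (u /\<^sub>R N u - v /\<^sub>R N v) = norm (N v *\<^sub>R u - N u *\<^sub>R v) / (N u * N v)"
    using pos by (simp add: divide_inverse mult.commute)
  also have "\<dots> \<le> norm (u - v) / (1 / K * (1 / K))"
    using pos K lower uv
    by (intro frac_le norm_cross_scaled_le N mult_mono) auto
  finally show ?thesis
    using K by (simp add: power2_eq_square mult.commute)
qed

text \<open>With \<open>r\<close>, \<open>s\<close> the norms and \<open>c\<close> the cosine of the
  angle, the squared distances differ by \<open>(r - s)\<^sup>2 + (r * s - 1) * (2 - 2 * c)\<close>,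
  which is nonnegative.\<close>

lemma norm_scaleR_inverse_norm_diff_le:
  fixes x y :: "'a::real_inner"
  assumes "1 \<le> norm x" "1 \<le> norm y"
  shows "norm (x /\<^sub>R norm x - y /\<^sub>R norm y) \<le> norm (x - y)"
proof -
  define r s c where "r = norm x" and "s = norm y" and "c = inner (x /\<^sub>R r) (y /\<^sub>R s)"
  have rs: "1 \<le> r" "1 \<le> s" using assms by (auto simp: r_def s_def)
  have xy: "inner x y = r * s * c"
    using rs by (simp add: c_def field_simps)
  have xx: "inner x x = r\<^sup>2" "inner y y = s\<^sup>2"
    by (simp_all add: r_def s_def dot_square_norm)
  have "inner x y \<le> r * s"
    by (simp add: r_def s_def norm_cauchy_schwarz)
  then have "c \<le> 1"
    using rs xy by simp
  moreover have "1 * 1 \<le> r * s"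
    using rs by (intro mult_mono) auto
  ultimately have "0 \<le> (r - s)\<^sup>2 + (r * s - 1) * (2 - 2 * c)"
    by simp
  also have "\<dots> = inner (x - y) (x - y) - (2 - 2 * c)"
    by (simp add: inner_diff inner_commute xx xy power2_eq_square algebra_simps)
  also have "2 - 2 * c = inner (x /\<^sub>R r - y /\<^sub>R s) (x /\<^sub>R r - y /\<^sub>R s)"
    using rs by (simp add: inner_diff inner_commute xx xy power2_eq_square field_simps)
  finally show ?thesis
    by (simp add: norm_eq_sqrt_inner r_def s_def)
qed

section \<open>Arcs of the unit circle\<close>

lemma Jordan_inequality:
  fixes x :: real
  assumes "0 \<le> x" "x \<le> pi / 2"
  shows "2 / pi * x \<le> sin x"
proof -
  have "concave_on {0..pi/2} sin"
    by (rule f''_le0_imp_concave[where f' = cos and f'' = "\<lambda>x. - sin x"])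
       (auto intro!: derivative_eq_intros sin_ge_zero)
  \<comment> \<open>The weight \<open>2 / pi * x\<close> between \<open>0\<close> and
    \<open>pi / 2\<close> gives the point \<open>x\<close>, and the chord of the sine has height
    \<open>2 / pi * x\<close> there.\<close>
  from concave_onD[OF this, of "2 / pi * x" 0 "pi / 2"] show ?thesis
    using assms by (simp add: field_simps)
qed

lemma norm_cis_diff: "norm (cis s - cis t) = 2 * \<bar>sin ((s - t) / 2)\<bar>"
proof -
  have "cis s - cis t = cis t * (exp (\<i> * of_real (s - t)) - 1)"
    by (simp add: cis_mult cis_conv_exp algebra_simps flip: exp_add)
  then show ?thesis
    by (simp only: norm_mult norm_cis dist_exp_i_1 mult_1)
qed

text \<open>A shortest arc from \<open>u\<close> to \<open>v\<close>, run at constant speed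
  \<open>\<theta>\<close>, the angle between them. The rotation extends to all real times.\<close>

lemma complex_unit_circle_arc:
  fixes u v :: complex
  assumes "norm u = 1" "norm v = 1"
  obtains \<theta> g where "0 \<le> \<theta>" "\<theta> \<le> pi / 2 * norm (u - v)" "g 0 = u" "g 1 = v"
    "\<And>t. norm (g t) = 1" "\<And>s t::real. norm (g s - g t) \<le> \<theta> * \<bar>s - t\<bar>"
proof -
  define \<phi> where "\<phi> = Arg (v / u)"
  have u: "u \<noteq> 0" and "v \<noteq> 0" using assms by auto
  then have cis: "cis \<phi> = v / u"
    using assms by (simp add: \<phi>_def cis_Arg sgn_eq norm_divide)
  \<comment> \<open>The principal argument is at most \<open>pi\<close> in absolute value, so its
    half is in the range of Jordan's inequality. This is the source of the factor
    \<open>pi / 2\<close>.\<close>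
  have "2 / pi * (\<bar>\<phi>\<bar> / 2) \<le> sin (\<bar>\<phi>\<bar> / 2)"
    using Arg_bounded[of "v / u"] by (intro Jordan_inequality) (auto simp: \<phi>_def)
  also have "\<dots> \<le> \<bar>sin (\<phi> / 2)\<bar>"
    by (cases "0 \<le> \<phi>") auto
  also have "2 * \<bar>sin (\<phi> / 2)\<bar> = norm (u * (cis \<phi> - cis 0))"
    using assms by (simp add: norm_mult norm_cis_diff del: cis_zero)
  then have "\<bar>sin (\<phi> / 2)\<bar> = norm (u - v) / 2"
    using u cis by (simp add: right_diff_distrib norm_minus_commute)
  finally have \<phi>: "\<bar>\<phi>\<bar> \<le> pi / 2 * norm (u - v)"
    by (simp add: field_simps)
  show thesis
  proof (rule that[of "\<bar>\<phi>\<bar>" "\<lambda>t. u * cis (t * \<phi>)"])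
    show "norm (u * cis (s * \<phi>) - u * cis (t * \<phi>)) \<le> \<bar>\<phi>\<bar> * \<bar>s - t\<bar>" for s t
    proof -
      have "norm (u * cis (s * \<phi>) - u * cis (t * \<phi>)) = norm (cis (s * \<phi>) - cis (t * \<phi>))"
        using assms by (simp add: norm_mult flip: right_diff_distrib)
      also have "\<dots> \<le> 2 * \<bar>(s * \<phi> - t * \<phi>) / 2\<bar>"
        unfolding norm_cis_diff by (intro mult_left_mono abs_sin_x_le_abs_x) auto
      also have "\<dots> = \<bar>\<phi>\<bar> * \<bar>s - t\<bar>"
        by (simp add: algebra_simps flip: abs_mult)
      finally show ?thesis .
    qed
  qed (use \<phi> assms u cis in \<open>auto simp: norm_mult\<close>)
qed

text \<open>The arc is transported from the complex plane by a linear isometry.\<close>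

lemma unit_circle_arc:
  fixes u v :: "'a::euclidean_space"
  assumes "DIM('a) = 2" "norm u = 1" "norm v = 1"
  obtains \<theta> g where "0 \<le> \<theta>" "\<theta> \<le> pi / 2 * norm (u - v)" "g 0 = u" "g 1 = v"
    "\<And>t. norm (g t) = 1" "\<And>s t::real. norm (g s - g t) \<le> \<theta> * \<bar>s - t\<bar>"
proof -
  have "DIM('a) = DIM(complex)" using assms(1) by simp
  from isomorphisms_UNIV_UNIV[OF this]
  obtain F :: "'a \<Rightarrow> complex" and G where lin: "linear F" "linear G"
    and nF: "\<And>x. norm (F x) = norm x" and nG: "\<And>z. norm (G z) = norm z"
    and GF: "\<And>x. G (F x) = x"
    by metis
  have "norm (F u) = 1" "norm (F v) = 1" using assms nF by auto
  then obtain \<theta> g where g: "0 \<le> \<theta>" "\<theta> \<le> pi / 2 * norm (F u - F v)" "g 0 = F u" "g 1 = F v"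
    "\<And>t. norm (g t) = 1" "\<And>s t::real. norm (g s - g t) \<le> \<theta> * \<bar>s - t\<bar>"
    using complex_unit_circle_arc by metis
  show thesis
    by (rule that[of \<theta> "\<lambda>t. G (g t)"])
       (use g nF nG GF in \<open>auto simp flip: linear_diff[OF lin(1)] linear_diff[OF lin(2)]\<close>)
qed

section \<open>Lengths of paths\<close>

lemma path_length_lipschitz_le:
  assumes "\<And>s t. N (p s - p t) \<le> C * \<bar>s - t\<bar>"
  shows "path_length N p \<le> ennreal C"
  unfolding path_length_def
proof (rule Sup_least, clarify)
  fix n :: nat and t :: "nat \<Rightarrow> real"
  assume t: "strict_mono_on {0..n} t" "t 0 = 0" "t n = 1"
  \<comment> \<open>The partition points increase, so the bound has no absolute values and
    telescopes to \<open>C * (1 - 0)\<close>.\<close>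
  have "(\<Sum>j<n. N (p (t j) - p (t (Suc j)))) \<le> (\<Sum>j<n. C * (t (Suc j) - t j))"
  proof (rule sum_mono)
    fix j assume "j \<in> {..<n}"
    then have "t j < t (Suc j)"
      by (intro strict_mono_onD[OF t(1)]) auto
    then show "N (p (t j) - p (t (Suc j))) \<le> C * (t (Suc j) - t j)"
      using assms[of "t j" "t (Suc j)"] by simp
  qed
  also have "\<dots> = C"
    using t by (simp add: sum_lessThan_telescope flip: sum_distrib_left)
  finally show "ennreal (\<Sum>j<n. N (p (t j) - p (t (Suc j)))) \<le> ennreal C"
    by (rule ennreal_leI)
qed

lemma dist_le_path_length:
  "ennreal (N (pathstart p - pathfinish p)) \<le> path_length N p"
  unfolding path_length_def
  \<comment> \<open>The witness is the coarsest partition, with the points 0 and 1 only.\<close>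
  by (rule Sup_upper, rule CollectI, intro exI[of _ "1::nat"] exI[of _ real])
     (auto simp: pathstart_def pathfinish_def strict_mono_on_def)

theorem theorem3p5:
  fixes X :: "real ^ 2 \<Rightarrow> real" and K :: real and x y :: "real ^ 2"
  assumes "is_norm X"
    and "K \<ge> 1"
    and "unit_ball norm \<subseteq> unit_ball X"
    and "unit_ball X \<subseteq> (\<lambda>w. K *\<^sub>R w) ` unit_ball norm"
    and "x \<in> unit_sphere X" and "y \<in> unit_sphere X"
  shows "ennreal (X (x - y)) \<le> intrinsic_dist X x y \<and>
         intrinsic_dist X x y \<le> ennreal (K ^ 3 * (pi / 2) * X (x - y))"
proof
  show "ennreal (X (x - y)) \<le> intrinsic_dist X x y"
    unfolding intrinsic_dist_def
    by (rule Inf_greatest) (use dist_le_path_length in blast)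
next
  have hom: "X (r *\<^sub>R w) = \<bar>r\<bar> * X w" and pos: "w \<noteq> 0 \<Longrightarrow> 0 < X w" for r w
    using assms(1) by (auto simp: is_norm_def order_less_le)
  have X0: "X 0 = 0" using assms(1) by (simp add: is_norm_def)
  \<comment> \<open>By homogeneity, each inclusion of balls becomes an inequality between the
    norms.\<close>
  have le_norm: "X w \<le> norm w" for w
  proof (cases "w = 0")
    case False
    then have "w /\<^sub>R norm w \<in> unit_ball norm"
      by (simp add: unit_ball_def)
    then have "X (w /\<^sub>R norm w) \<le> 1"
      using assms(3) unfolding unit_ball_def by blast
    then show ?thesis
      using False by (simp add: hom field_simps)
  qed (simp add: X0)
  have norm_le: "norm w \<le> K * X w" for w
  proof (cases "w = 0")
    case False
    have "w /\<^sub>R X w \<in> unit_ball X"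
      using pos[OF False] by (simp add: unit_ball_def hom)
    then obtain z where "w /\<^sub>R X w = K *\<^sub>R z" "norm z \<le> 1"
      using assms(4) by (auto simp: unit_ball_def)
    then have "norm (w /\<^sub>R X w) \<le> K"
      using assms(2) by simp
    then show ?thesis
      using pos[OF False] by (simp add: field_simps)
  qed (simp add: X0)
  have xy: "X x = 1" "X y = 1"
    using assms(5,6) by (auto simp: unit_sphere_def)
  then have nxy: "1 \<le> norm x" "1 \<le> norm y"
    using le_norm by metis+
  then have nz: "x \<noteq> 0" "y \<noteq> 0" by auto
  obtain \<theta> g where g: "0 \<le> \<theta>" "\<theta> \<le> pi / 2 * norm (x /\<^sub>R norm x - y /\<^sub>R norm y)"
    "g 0 = x /\<^sub>R norm x" "g 1 = y /\<^sub>R norm y"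
    "\<And>t. norm (g t) = 1" "\<And>s t::real. norm (g s - g t) \<le> \<theta> * \<bar>s - t\<bar>"
    using unit_circle_arc[of "x /\<^sub>R norm x" "y /\<^sub>R norm y"] nz by auto
  define p where "p = (\<lambda>t. g t /\<^sub>R X (g t))"
  have lip: "norm (p s - p t) \<le> K\<^sup>2 * \<theta> * \<bar>s - t\<bar>" for s t
  proof -
    have "norm (p s - p t) \<le> K\<^sup>2 * norm (g s - g t)"
      unfolding p_def
      using assms(1,2) le_norm norm_le g(5) by (intro norm_radial_projection_diff_le) auto
    also have "\<dots> \<le> K\<^sup>2 * (\<theta> * \<bar>s - t\<bar>)"
      by (intro mult_left_mono g) auto
    finally show ?thesis by simp
  qed
  have "(K\<^sup>2 * \<theta>)-lipschitz_on UNIV p"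
    using lip g(1) by (intro lipschitz_onI) (auto simp: dist_norm)
  then have "path p"
    unfolding path_def
    by (meson continuous_on_subset lipschitz_on_continuous_on subset_UNIV)
  moreover have "path_image p \<subseteq> unit_sphere X"
  proof -
    have "X (g t) > 0" "X (g t) \<noteq> 0" for t
      using g(5)[of t] pos[of "g t"] by force+
    then show ?thesis
      by (auto simp: path_image_def unit_sphere_def p_def hom abs_of_pos)
  qed
  \<comment> \<open>Projecting \<open>x /\<^sub>R norm x\<close> back to the sphere of
    \<open>X\<close> returns \<open>x\<close> because \<open>X x = 1\<close>; likewise for
    \<open>y\<close>.\<close>
  moreover have "pathstart p = x" "pathfinish p = y"
    using nz xy by (auto simp: pathstart_def pathfinish_def p_def g hom)
  ultimately have "intrinsic_dist X x y \<le> path_length X p"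
    unfolding intrinsic_dist_def by (intro Inf_lower) blast
  also have "\<dots> \<le> ennreal (K\<^sup>2 * \<theta>)"
    \<comment> \<open>The Euclidean Lipschitz bound also bounds the length in \<open>X\<close>, as
      \<open>X\<close> is at most \<open>norm\<close>.\<close>
    using lip le_norm order_trans by (intro path_length_lipschitz_le) blast
  \<comment> \<open>The third factor \<open>K\<close> comes from passing from
    \<open>norm (x - y)\<close> to \<open>X (x - y)\<close>.\<close>
  also have "\<dots> \<le> ennreal (K ^ 3 * (pi / 2) * X (x - y))"
  proof (rule ennreal_leI)
    have "\<theta> \<le> pi / 2 * norm (x - y)"
      by (rule order_trans[OF g(2)])
         (intro mult_left_mono norm_scaleR_inverse_norm_diff_le nxy, simp)
    also have "\<dots> \<le> pi / 2 * (K * X (x - y))"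
      by (intro mult_left_mono norm_le) auto
    finally have "K\<^sup>2 * \<theta> \<le> K\<^sup>2 * (pi / 2 * (K * X (x - y)))"
      by (intro mult_left_mono) auto
    then show "K\<^sup>2 * \<theta> \<le> K ^ 3 * (pi / 2) * X (x - y)"
      by (simp add: power2_eq_square power3_eq_cube mult_ac)
  qed
  finally show "intrinsic_dist X x y \<le> ennreal (K ^ 3 * (pi / 2) * X (x - y))" .
qed

end
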